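(* There exists an absolute constant $c>0$ such that $v(k)\ge e^{ck^2}$ holds for all positive integers $k$.
   Context: For a positive integer $k$, let $S_k$ denote the set of all $k$-tuples $(n_1,\dots,n_k)$ of integers with $1\le n_1<n_2<\cdots<n_k$ satisfying $1=\frac{1}{n_1}+\cdots+\frac{1}{n_k}$ (pairwise distinct denominators). Let $D_k$ be the set of all integers $m$ such that $m=n_i$ for some $(n_1,\dots,n_k)\in S_k$ and some $1\le i\le k$. Define $v(k)$ to be the smallest integer larger than $1$ that is not contained in $D_k$. *)

theory Defs
  imports Complex_Main
begin

text \<open>
  Tuples $(n_1, \dots, n_k)$ are lists of length \<open>k\<close>; \<open>sorted_wrt (<)\<close> expresses
  $n_1 < n_2 < \dots < n_k$.  All denominators are positive, so the integers involved are
  taken from \<open>nat\<close>.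
\<close>

definition S :: "nat \<Rightarrow> nat list set" where
  "S k = {ns. length ns = k \<and> sorted_wrt (<) ns \<and> (\<forall>n\<in>set ns. 1 \<le> n) \<and>
              (\<Sum>n\<leftarrow>ns. 1 / real n) = 1}"

definition D :: "nat \<Rightarrow> nat set" where
  "D k = {m. \<exists>ns\<in>S k. m \<in> set ns}"

definition v :: "nat \<Rightarrow> nat" where
  "v k = (LEAST m. 1 < m \<and> m \<notin> D k)"

text \<open>The minimum defining \<open>v\<close> is attained, because each \<open>D k\<close> is finite.\<close>

lemma finite_unit_fraction_sums:
  "finite {ns. length ns = k \<and> sorted_wrt (<) ns \<and> (\<forall>n\<in>set ns. 1 \<le> n) \<and>
               (\<Sum>n\<leftarrow>ns. 1 / real n) = r}"
  (is "finite (?A k r)")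
proof (induction k arbitrary: r)
  case 0
  have "?A 0 r \<subseteq> {[]}" by auto
  then show ?case by (rule finite_subset) simp
next
  case (Suc k)
  let ?B = "\<Union>n\<in>{..nat \<lfloor>real (Suc k) / r\<rfloor>}. (#) n ` ?A k (r - 1 / real n)"
  have "?A (Suc k) r \<subseteq> ?B"
  proof
    fix ns assume ns: "ns \<in> ?A (Suc k) r"
    then obtain n ms where eq: "ns = n # ms" by (cases ns) auto
    have n: "1 \<le> n" and ms: "ms \<in> ?A k (r - 1 / real n)"
      using ns eq by auto
    have "(\<Sum>m\<leftarrow>ms. 1 / real m) \<le> (\<Sum>m\<leftarrow>ms. 1 / real n)"
      using ns eq n by (intro sum_list_mono) (auto intro!: divide_left_mono)
    also have "\<dots> = real k / real n"
      using ns eq by (simp add: sum_list_triv)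
    finally have "r \<le> real (Suc k) / real n"
      using ns eq by (simp add: add_divide_distrib)
    moreover have "0 < r"
    proof -
      have "0 \<le> (\<Sum>m\<leftarrow>ms. 1 / real m)" by (rule sum_list_nonneg) auto
      moreover have "0 < 1 / real n" using n by simp
      moreover have "r = 1 / real n + (\<Sum>m\<leftarrow>ms. 1 / real m)" using ns eq by auto
      ultimately show ?thesis by linarith
    qed
    ultimately have "real n \<le> real (Suc k) / r"
      using n by (simp add: field_simps)
    then have "n \<le> nat \<lfloor>real (Suc k) / r\<rfloor>" by (simp add: le_nat_floor)
    then show "ns \<in> ?B" using ms eq by blast
  qed
  moreover have "finite ?B" using Suc.IH by blast
  ultimately show ?case by (rule finite_subset)
qed

lemma finite_D: "finite (D k)"
proof -
  have "D k = (\<Union>ns\<in>S k. set ns)" by (auto simp: D_def)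
  moreover have "finite (S k)" unfolding S_def by (rule finite_unit_fraction_sums)
  ultimately show ?thesis by simp
qed

lemma v_attained: "1 < v k \<and> v k \<notin> D k"
proof -
  have "finite (D k \<union> {..1})" using finite_D by simp
  then obtain m where "m \<notin> D k \<union> {..1}" using ex_new_if_finite infinite_UNIV_nat by blast
  then have "1 < m \<and> m \<notin> D k" by auto
  then show ?thesis unfolding v_def by (rule LeastI)
qed

end

theory Submission
  imports Defs
begin

text \<open>
  For $1 < m \le 2^{t^2}$ it suffices to write $1$ as a sum of $O(t)$ distinct unit fractions,
  one of them $1/m$ and one smaller than $1/m$: splitting the smallest fraction $1/M$ as
  $1/(M+1) + 1/(M(M+1))$ then reaches every larger length.

  Let $P_t = \prod_{i \le t} (2^i + 1)$ and $N = 2^s P_t$.  As in Briggs' method for logarithms,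
  greedily chosen products of the factors $1 + 2^{-i}$ approximate every number of $[1, 2)$, so that
  every $r$ with $2^{u^2} \le r < 2^{s+1}$, $u \le t$, has a divisor $d$ of $N$ with
  $d \le r < d (1 + 2^{-u})$.  Subtracting $d$ removes $u$ binary digits from $r$; since $u$ may be
  taken of order $\sqrt{\log r}$ (up to $t$), numbers up to $2^{O(t^2)}$ are sums of $O(t)$
  distinct divisors of $N$.

  A fraction $a/b$ is then expanded by writing $aN = qb + r$ with $r < b$ and expanding $q$ and $r$.
  This requires $q < 2^{s}$, so $a/b$ must be small; the fraction $1 - 1/m$ is brought
  below $2^{-2t^2}$ by the greedy algorithm of Fibonacci, which squares the remainder at each step.
\<close>

section \<open>Products of the numbers 2^i + 1 and their dense divisors\<close>

definition pow2_succ_prod :: "nat \<Rightarrow> nat" where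
  "pow2_succ_prod t = (\<Prod>i=1..t. 2 ^ i + 1)"

lemma pow2_succ_prod_Suc: "pow2_succ_prod (Suc t) = pow2_succ_prod t * (2 ^ Suc t + 1)"
  by (simp add: pow2_succ_prod_def)

lemma pow2_succ_prod_pos: "0 < pow2_succ_prod t"
  by (simp add: pow2_succ_prod_def)

lemma pow2_succ_prod_dvd_mono: "u \<le> t \<Longrightarrow> pow2_succ_prod u dvd pow2_succ_prod t"
  by (induction t rule: dec_induct) (auto simp: pow2_succ_prod_Suc)

lemma pow2_succ_prod_le: "pow2_succ_prod t \<le> 2 ^ (2 * t * t)"
proof -
  have "pow2_succ_prod t \<le> (\<Prod>i=1..t. 2 ^ (2 * t))"
    unfolding pow2_succ_prod_def
  proof (rule prod_mono)
    fix i assume i: "i \<in> {1..t}"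
    have "(2::nat) ^ i + 1 \<le> 2 ^ (i + 1)" by simp
    also have "\<dots> \<le> 2 ^ (2 * t)" using i by (intro power_increasing) auto
    finally show "0 \<le> (2::nat) ^ i + 1 \<and> (2::nat) ^ i + 1 \<le> 2 ^ (2 * t)" by simp
  qed
  also have "\<dots> = 2 ^ (2 * t * t)" by (simp add: power_mult)
  finally show ?thesis .
qed

text \<open>If the quotient r / (2^j e), known to lie in [1, 1 + 2^-u), is not yet below 1 +
  2^-(u+1), divide it by 1 + 2^-(u+1): this trades u + 1 factors 2 of the divisor for one factor
  2^(u+1) + 1. The bound \<open>a \<le> j + u * u\<close> records that few factors 2 have been
  spent.\<close>

lemma dense_divisor:
  fixes r :: nat
  assumes "2 ^ a \<le> r" "r < 2 ^ (a + 1)" "u * u \<le> a"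
  shows "\<exists>j e. j \<le> a \<and> a \<le> j + u * u \<and> e dvd pow2_succ_prod u \<and> 2 ^ j * e \<le> r \<and>
    2 ^ u * r < 2 ^ j * e * (2 ^ u + 1)"
  using assms(3)
proof (induction u)
  case 0
  then show ?case using assms(1,2) by (intro exI[of _ a] exI[of _ 1]) auto
next
  case (Suc u)
  then obtain j e where je: "j \<le> a" "a \<le> j + u * u" "e dvd pow2_succ_prod u" "2 ^ j * e \<le> r"
    "2 ^ u * r < 2 ^ j * e * (2 ^ u + 1)" by auto
  show ?case
  proof (cases "2 ^ Suc u * r < 2 ^ j * e * (2 ^ Suc u + 1)")
    case True
    then show ?thesis using je by (intro exI[of _ j] exI[of _ e]) (auto simp: pow2_succ_prod_Suc)
  next
    case False
    \<comment> \<open>Enough factors 2 remain for the trade: j \<ge> a - u^2 \<ge> (u+1)^2 -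
      u^2.\<close>
    have ju: "Suc u \<le> j" using je Suc.prems by simp
    define d where "d = 2 ^ (j - Suc u) * e"
    define X :: nat where "X = 2 ^ u"
    have d: "2 ^ j * e = 2 * X * d"
      using ju by (simp add: d_def X_def power_diff_power_eq flip: power_Suc power_add)
    have X: "0 < X" by (simp add: X_def)
    have d': "2 ^ (j - Suc u) * (e * (2 ^ Suc u + 1)) = d * (2 * X + 1)"
      by (simp add: d_def X_def algebra_simps)
    have X2: "2 ^ Suc u = 2 * X" by (simp add: X_def)
    have "2 * X * (d * (2 * X + 1)) \<le> 2 * X * r"
      using False unfolding d X2 by (simp only: not_less mult.assoc)
    then have le: "d * (2 * X + 1) \<le> r" using X by simp
    have "X * r < 2 * X * d * (X + 1)" using je(5) unfolding d by (simp only: X_def)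
    then have "X * r < X * (2 * d * (X + 1))" by (simp only: ac_simps)
    then have "r < 2 * d * (X + 1)" using X by simp
    then have "2 * X * r \<le> 2 * X * (2 * d * (X + 1))" by (intro mult_left_mono) auto
    \<comment> \<open>This is 1 + 1/X < (1 + 1/(2X))^2: one factor suffices to reach the finer
      precision.\<close>
    also have "\<dots> < d * (2 * X + 1) * (2 * X + 1)"
    proof -
      have "0 < d" using \<open>r < 2 * d * (X + 1)\<close> by (cases d) auto
      then show ?thesis by (simp add: algebra_simps)
    qed
    finally have less: "2 * X * r < d * (2 * X + 1) * (2 * X + 1)" .
    have "e * (2 ^ Suc u + 1) dvd pow2_succ_prod (Suc u)"
      using je(3) by (simp only: pow2_succ_prod_Suc mult_dvd_mono dvd_refl)
    moreover have "a \<le> j - Suc u + Suc u * Suc u" using je(2) ju by simp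
    ultimately show ?thesis using le less d' je(1) X2
      by (intro exI[of _ "j - Suc u"] exI[of _ "e * (2 ^ Suc u + 1)"]) auto
  qed
qed

section \<open>Integers as sums of few distinct divisors\<close>

definition divisor_sums :: "nat \<Rightarrow> nat \<Rightarrow> nat \<Rightarrow> bool" where
  "divisor_sums N n c \<longleftrightarrow>
    (\<forall>r<2 ^ c. \<exists>A. finite A \<and> (\<forall>d\<in>A. d dvd N) \<and> card A \<le> n \<and> \<Sum>A = r)"

lemma divisor_sums_mono:
  assumes "divisor_sums N n c" "n \<le> n'" "c' \<le> c"
  shows "divisor_sums N n' c'"
proof -
  have "r < 2 ^ c" if "r < 2 ^ c'" for r :: nat
    using that assms(3) power_increasing[of c' c "2::nat"] by linarith
  then show ?thesis using assms(1,2) unfolding divisor_sums_def by (meson order_trans)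
qed

text \<open>One more divisor buys u more bits: for r \<ge> 2^c a dense divisor d leaves r - d < d /
  2^u < 2^c. The bound on c + u keeps the power of 2 in d within 2^s.\<close>

lemma divisor_sums_step:
  assumes N: "N = 2 ^ s * pow2_succ_prod t"
    and rep: "divisor_sums N n c"
    and u: "u * u \<le> c" "u \<le> t" "c + u \<le> s + 1"
  shows "divisor_sums N (Suc n) (c + u)"
  unfolding divisor_sums_def
proof (intro allI impI)
  fix r :: nat assume r: "r < 2 ^ (c + u)"
  show "\<exists>A. finite A \<and> (\<forall>d\<in>A. d dvd N) \<and> card A \<le> Suc n \<and> \<Sum>A = r"
  proof (cases "r < 2 ^ c")
    case True
    then show ?thesis using rep unfolding divisor_sums_def by (meson le_SucI)
  next
    case False
    then have "1 \<le> r" using one_le_power[of "2::nat" c] by linarith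
    then obtain a where a: "2 ^ a \<le> r" "r < 2 ^ (a + 1)"
      using ex_power_ivl1[of 2 r] by auto
    have "(2::nat) ^ c < 2 ^ (a + 1)" using a False by linarith
    then have "c < a + 1" by (rule power_less_imp_less_exp[rotated]) simp
    then have ca: "c \<le> a" by simp
    have "(2::nat) ^ a < 2 ^ (c + u)" using a r by linarith
    then have as: "a \<le> s" using u by (simp add: power_strict_increasing_iff)
    obtain j e where je: "j \<le> a" "e dvd pow2_succ_prod u" "2 ^ j * e \<le> r"
      "2 ^ u * r < 2 ^ j * e * (2 ^ u + 1)"
      using dense_divisor[OF a, of u] u ca by auto
    define d where "d = 2 ^ j * e"
    have dN: "d dvd N"
      unfolding N d_def using je as u pow2_succ_prod_dvd_mono[of u t]
      by (intro mult_dvd_mono le_imp_power_dvd) (auto intro: dvd_trans)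
    have dr: "d \<le> r" using je d_def by simp
    have lt: "2 ^ u * (r - d) < d"
    proof -
      obtain k where k: "r = d + k" using dr le_Suc_ex by blast
      have "2 ^ u * r < d * (2 ^ u + 1)" using je by (simp add: d_def)
      then show ?thesis using k by (simp add: algebra_simps)
    qed
    have "2 ^ u * (r - d) < 2 ^ u * 2 ^ c"
      using lt dr r by (simp only: power_add mult.commute[of "2 ^ c"])
    then have "r - d < 2 ^ c" by simp
    then obtain A where A: "finite A" "\<forall>x\<in>A. x dvd N" "card A \<le> n" "\<Sum>A = r - d"
      using rep unfolding divisor_sums_def by meson
    \<comment> \<open>The divisors used for the remainder are at most r - d, so d is not among
      them.\<close>
    have "r - d < d" using lt
      by (metis le_less_trans mult_le_mono1 nat_mult_1 one_le_numeral one_le_power)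
    then have "d \<notin> A" using A(1,4) member_le_sum[of d A "\<lambda>x. x"] by auto
    then show ?thesis using A dN dr by (intro exI[of _ "insert d A"]) auto
  qed
qed

text \<open>Passing from u^2 to (u+1)^2 needs 2u + 1 bits, and three steps of u bits each provide 3u
  \<ge> 2u + 1.\<close>

lemma divisor_sums_square:
  assumes N: "N = 2 ^ s * pow2_succ_prod t" and "1 \<le> u" "u \<le> t" "t * t + 3 * t \<le> s"
  shows "divisor_sums N (3 * u) (u * u)"
  using assms(2,3)
proof (induction u rule: nat_induct_at_least)
  case base
  have "\<exists>A. finite A \<and> (\<forall>d\<in>A. d dvd N) \<and> card A \<le> 3 \<and> \<Sum>A = r" if "r < 2" for r
    using that by (intro exI[of _ "if r = 0 then {} else {1}"]) auto
  then show ?case unfolding divisor_sums_def by simp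
next
  case (Suc u)
  have "u * u + 3 * u \<le> s"
    using Suc.prems assms(4) mult_le_mono[of u t u t] by simp
  then have "divisor_sums N (Suc (Suc (Suc (3 * u)))) (u * u + u + u + u)"
    using Suc by (intro divisor_sums_step[OF N]) auto
  then show ?case using Suc.hyps by (elim divisor_sums_mono) auto
qed

text \<open>Once t^2 bits are reached, every further divisor gains the maximal t bits.\<close>

lemma divisor_sums_linear:
  assumes N: "N = 2 ^ s * pow2_succ_prod t" and "1 \<le> t" "t * t + 3 * t \<le> s" "t * t + l * t \<le> s"
  shows "divisor_sums N (3 * t + l) (t * t + l * t)"
  using assms(4)
proof (induction l)
  case 0
  then show ?case using divisor_sums_square[OF N, of t] assms by simp
next
  case (Suc l)
  then have "divisor_sums N (Suc (3 * t + l)) (t * t + l * t + t)"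
    by (intro divisor_sums_step[OF N]) auto
  then show ?case by (simp add: algebra_simps)
qed

text \<open>Here 20t linear steps follow the 3t initial divisors. The resulting 21t^2 bits match the
  size of the denominators left by the greedy reduction.\<close>

lemma divisor_sums_modulus:
  assumes "1 \<le> t"
  shows "divisor_sums (2 ^ (21 * t * t) * pow2_succ_prod t) (23 * t) (21 * t * t)"
  using divisor_sums_linear[OF refl, of t "21 * t * t" "20 * t"] assms
  by (simp add: mult.assoc)

section \<open>Expanding small fractions by divisors of N\<close>

definition egyptian :: "nat set \<Rightarrow> real \<Rightarrow> bool" where
  "egyptian A x \<longleftrightarrow> finite A \<and> (\<forall>n\<in>A. 0 < n) \<and> (\<Sum>n\<in>A. 1 / real n) = x"

text \<open>For d dividing N, d / (bN) is the unit fraction with denominator b(N/d), and distinct d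
  give distinct denominators.\<close>

lemma egyptian_divisors:
  assumes "0 < N" "0 < b" "finite A" "\<forall>d\<in>A. d dvd N"
  shows "egyptian ((\<lambda>d. b * (N div d)) ` A) (real (\<Sum>A) / (real b * real N))"
    "card ((\<lambda>d. b * (N div d)) ` A) = card A"
proof -
  have pos: "0 < N div d" if "d \<in> A" for d
    using that assms by (auto simp: div_greater_zero_iff dvd_imp_le intro: dvd_pos_nat)
  have inj: "inj_on (\<lambda>d. b * (N div d)) A"
  proof (rule inj_onI)
    fix d d' assume *: "d \<in> A" "d' \<in> A" "b * (N div d) = b * (N div d')"
    then have "N div d = N div d'" using assms by simp
    moreover have "d * (N div d) = N" "d' * (N div d') = N"
      using *(1,2) assms(4) by (auto intro: dvd_mult_div_cancel)
    ultimately have "d * (N div d) = d' * (N div d)" by metis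
    then show "d = d'" using pos[OF *(1)] by simp
  qed
  show "card ((\<lambda>d. b * (N div d)) ` A) = card A" by (rule card_image[OF inj])
  have "(\<Sum>n\<in>(\<lambda>d. b * (N div d)) ` A. 1 / real n) = (\<Sum>d\<in>A. real d / (real b * real N))"
    unfolding sum.reindex[OF inj] using assms
    by (intro sum.cong) (auto simp: real_of_nat_div)
  also have "\<dots> = real (\<Sum>A) / (real b * real N)"
    by (simp add: sum_divide_distrib)
  finally show "egyptian ((\<lambda>d. b * (N div d)) ` A) (real (\<Sum>A) / (real b * real N))"
    unfolding egyptian_def using pos assms by auto
qed

lemma egyptian_Un:
  assumes "egyptian A x" "egyptian B y" "A \<inter> B = {}"
  shows "egyptian (A \<union> B) (x + y)"
  using assms by (auto simp: egyptian_def sum.union_disjoint)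

lemma egyptian_insert:
  assumes "egyptian A x" "n \<notin> A" "0 < n"
  shows "egyptian (insert n A) (1 / real n + x)"
  using assms by (auto simp: egyptian_def)

lemma egyptian_member_le:
  assumes "egyptian A x" "n \<in> A"
  shows "1 / real n \<le> x"
  using assms member_le_sum[of n A "\<lambda>n. 1 / real n"] by (auto simp: egyptian_def)

text \<open>With aN = qb + r, a/b = q/N + r/(bN). The smallness of a/b absorbs the factor
  \<open>pow2_succ_prod t \<le> 2 ^ (2 * t * t)\<close> of N, which bounds q; r is bounded by b.
  Each numerator costs at most 23t divisors.\<close>

lemma small_fraction_egyptian:
  assumes "1 \<le> t" "0 < b" "b \<le> 2 ^ (21 * t * t)" "a * 2 ^ (2 * t * t) < b"
  shows "\<exists>B. egyptian B (real a / real b) \<and> card B \<le> 46 * t"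
proof -
  define N where "N = 2 ^ (21 * t * t) * pow2_succ_prod t"
  have N: "0 < N" by (simp add: N_def pow2_succ_prod_pos)
  define q where "q = a * N div b"
  define r where "r = a * N mod b"
  have qr: "a * N = q * b + r" by (simp add: q_def r_def)
  have "q < 2 ^ (21 * t * t)"
  proof -
    have "q * 2 ^ (2 * t * t) * b \<le> a * 2 ^ (2 * t * t) * N"
      using qr by (metis le_add1 mult.assoc mult.commute mult_le_mono1)
    also have "\<dots> < b * N" using assms N by simp
    finally have "q * 2 ^ (2 * t * t) < N" using assms(2) by (simp add: mult.commute)
    also have "\<dots> \<le> 2 ^ (21 * t * t) * 2 ^ (2 * t * t)"
      unfolding N_def using pow2_succ_prod_le by simp
    finally show ?thesis by simp
  qed
  then obtain Q where Q: "finite Q" "\<forall>d\<in>Q. d dvd N" "card Q \<le> 23 * t" "\<Sum>Q = q"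
    using divisor_sums_modulus[OF assms(1)] unfolding divisor_sums_def N_def by meson
  have rb: "r < b" using assms by (simp add: r_def)
  then have "r < 2 ^ (21 * t * t)" using assms by linarith
  then obtain R where R: "finite R" "\<forall>d\<in>R. d dvd N" "card R \<le> 23 * t" "\<Sum>R = r"
    using divisor_sums_modulus[OF assms(1)] unfolding divisor_sums_def N_def by meson
  let ?A = "(\<lambda>d. 1 * (N div d)) ` Q" and ?B = "(\<lambda>d. b * (N div d)) ` R"
  note A = egyptian_divisors[OF N zero_less_one Q(1,2)]
  note B = egyptian_divisors[OF N assms(2) R(1,2)]
  have "?A \<inter> ?B = {}"
  \<comment> \<open>A common denominator N/d = b(N/d') would force d' = db \<ge> b, but d' \<le> r <
    b.\<close>
  proof (rule ccontr)
    assume "?A \<inter> ?B \<noteq> {}"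
    then obtain d d' where *: "d \<in> Q" "d' \<in> R" "N div d = b * (N div d')" by auto
    have d: "d * (N div d) = N" and d': "d' * (N div d') = N"
      using *(1,2) Q(2) R(2) by (auto intro: dvd_mult_div_cancel)
    have "(d * b) * (N div d') = d' * (N div d')" using d d' *(3) by (simp add: mult.assoc)
    moreover have "0 < N div d'" using d' N by (cases "N div d'") auto
    ultimately have "d * b = d'" by simp
    moreover have "d' \<le> r" using *(2) R member_le_sum[of d' R "\<lambda>x. x"] by auto
    moreover have "0 < d" using d N by (cases d) auto
    ultimately show False using rb by (cases d) auto
  qed
  then have "egyptian (?A \<union> ?B) (real q / real N + real r / (real b * real N))"
    using egyptian_Un[OF A(1) B(1)] Q(4) R(4) by simp
  moreover have "real q / real N + real r / (real b * real N) = real a / real b"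
  proof -
    have "real a * real N = real q * real b + real r"
      using arg_cong[OF qr, of real] by simp
    moreover have "real q / real N + real r / (real b * real N) =
        (real q * real b + real r) / (real b * real N)"
      using assms(2) N by (simp add: field_simps)
    moreover have "real a * real N / (real b * real N) = real a / real b" using N by simp
    ultimately show ?thesis by metis
  qed
  moreover have "card (?A \<union> ?B) \<le> 46 * t"
    using card_Un_le[of ?A ?B] A(2) B(2) Q(3) R(3) by linarith
  ultimately show ?thesis by auto
qed

section \<open>Greedy reduction of 1 - 1/m\<close>

text \<open>Of the two smallest integers above 1/x, take the first that is not m. Then 1 < nx \<le>
  1 + 2x, so the remainder is at most 2x/n; this is below both 2x^2 and 1/n.\<close>

lemma greedy_step:
  fixes x :: real
  assumes x: "0 < x" "x < 1 / 4" and "1 / 2 ^ w \<le> x"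
  obtains n where "n \<noteq> m" "0 < n" "1 / real n < x" "x - 1 / real n \<le> 2 * x\<^sup>2"
    "n \<le> 2 ^ w + 2" "x - 1 / real n < 1 / real n"
proof -
  define f where "f = nat \<lfloor>1 / x\<rfloor>"
  have f: "real f \<le> 1 / x" "1 / x < real f + 1"
    using x by (auto simp: f_def)
  define n where "n = (if f + 1 = m then f + 2 else f + 1)"
  have n: "n \<noteq> m" "0 < n" "1 / x < real n" "real n \<le> 1 / x + 2"
    using f by (auto simp: n_def)
  have nx: "1 < real n * x" "real n * x \<le> 1 + 2 * x"
    using n x by (auto simp: field_simps)
  have xn: "1 / real n < x" using nx n by (simp add: field_simps)
  have "x - 1 / real n = (real n * x - 1) / real n" using n by (simp add: field_simps)
  also have "\<dots> \<le> 2 * x / real n" using nx n by (intro divide_right_mono) auto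
  also have "\<dots> = 2 * x * (1 / real n)" by simp
  finally have le: "x - 1 / real n \<le> 2 * x * (1 / real n)" .
  also have "\<dots> \<le> 2 * x * x" using xn x by (intro mult_left_mono) auto
  finally have "x - 1 / real n \<le> 2 * x\<^sup>2" by (simp add: power2_eq_square)
  moreover have "2 * x * (1 / real n) < 1 * (1 / real n)"
    using x n by (intro mult_strict_right_mono) auto
  moreover have "real n \<le> 2 ^ w + 2"
  proof -
    have "1 / x \<le> 2 ^ w" using assms by (simp add: field_simps)
    then show ?thesis using n by linarith
  qed
  then have "n \<le> 2 ^ w + 2" by (metis of_nat_add of_nat_le_iff of_nat_numeral of_nat_power)
  ultimately show thesis using that n xn le by auto
qed

text \<open>With w = 2^j, a step sends a remainder below 2^-(w+1) to one below 2 * 2^-(2w+2) =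
  2^-(2w+1). The last conjunct keeps every later denominator new. The start is 1/2 + 1/3, which
  leaves 1/6 - 1/m > 0 as m \<ge> 7.\<close>

lemma greedy_remainder:
  assumes m: "7 \<le> m"
  shows "\<exists>A a b. finite A \<and> m \<notin> A \<and> card A \<le> j + 2 \<and> 0 < a \<and> 0 < b \<and>
    b \<le> m * 16 ^ (2 ^ j + 1) \<and> real a / real b < 1 / 2 ^ (2 ^ j + 1) \<and>
    egyptian A (1 - 1 / real m - real a / real b) \<and> (\<forall>n\<in>A. real a / real b < 1 / real n)"
proof (induction j)
  case 0
  have x: "real (m - 6) / real (6 * m) = 1 / 6 - 1 / real m"
    using m by (simp add: field_simps of_nat_diff)
  have "0 < 1 / real m" using m by simp
  then have lt: "real (m - 6) / real (6 * m) < 1 / 6" unfolding x by linarith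
  have "egyptian {2, 3} (1 - 1 / real m - real (m - 6) / real (6 * m))"
    unfolding x by (simp add: egyptian_def)
  moreover have "real (m - 6) / real (6 * m) < 1 / 2 ^ (2 ^ 0 + 1)" using lt by simp
  moreover have "\<forall>n\<in>{2, 3}. real (m - 6) / real (6 * m) < 1 / real n"
    using lt unfolding ball_simps by simp
  moreover have "card {2, 3 :: nat} \<le> 0 + 2" "m \<notin> {2, 3}" "0 < m - 6" "0 < 6 * m"
    "6 * m \<le> m * 16 ^ (2 ^ 0 + 1)" "finite {2, 3 :: nat}"
    using m by auto
  ultimately show ?case by blast
next
  case (Suc j)
  define w :: nat where "w = 2 ^ j"
  from Suc obtain A a b where A: "finite A" "m \<notin> A" "card A \<le> j + 2" "0 < a" "0 < b"
    "b \<le> m * 16 ^ (w + 1)" "real a / real b < 1 / 2 ^ (w + 1)"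
    "egyptian A (1 - 1 / real m - real a / real b)" "\<forall>n\<in>A. real a / real b < 1 / real n"
    unfolding w_def by blast
  have w: "1 \<le> w" "2 ^ Suc j = 2 * w" by (auto simp: w_def)
  show ?case
  \<comment> \<open>A remainder that is already small enough is kept; otherwise its lower bound
    limits the next denominator n and hence the growth of b.\<close>
  proof (cases "real a / real b < 1 / 2 ^ (2 * w + 1)")
    case True
    have "m * 16 ^ (w + 1) \<le> m * 16 ^ (2 * w + 1)"
      by (intro mult_left_mono power_increasing) auto
    with A(6) have "b \<le> m * 16 ^ (2 * w + 1)" by linarith
    then show ?thesis using A True unfolding w(2)
      by (intro exI[of _ A] exI[of _ a] exI[of _ b]) auto
  next
    case False
    define x where "x = real a / real b"
    have x0: "0 < x" using A by (simp add: x_def)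
    have x1: "x < 1 / 2 ^ (w + 1)" using A by (simp add: x_def)
    also have "\<dots> \<le> 1 / 2 ^ 2" using w by (intro divide_left_mono power_increasing) auto
    finally have x2: "x < 1 / 4" by simp
    obtain n where n: "n \<noteq> m" "0 < n" "1 / real n < x" "x - 1 / real n \<le> 2 * x\<^sup>2"
      "n \<le> 2 ^ (2 * w + 1) + 2" "x - 1 / real n < 1 / real n"
      using greedy_step[OF x0 x2, of "2 * w + 1" m] False by (auto simp: x_def)
    have nA: "n \<notin> A" using A(9) n(3) by (auto simp: x_def)
    define a' where "a' = a * n - b"
    have "real b < real (a * n)" using n A by (simp add: x_def field_simps)
    then have ba: "b < a * n" by linarith
    have x': "real a' / real (b * n) = x - 1 / real n"
      using ba n A by (simp add: a'_def x_def field_simps of_nat_diff)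
    have "2 * x\<^sup>2 < 2 * (1 / 2 ^ (w + 1))\<^sup>2"
      using x0 x1 by (intro mult_strict_left_mono power_strict_mono) auto
    also have "\<dots> = 1 / 2 ^ (2 * w + 1)"
      by (simp add: power2_eq_square power_add power_mult field_simps)
    finally have small: "real a' / real (b * n) < 1 / 2 ^ (2 * w + 1)" using x' n by simp
    have "n \<le> 16 ^ w"
    proof -
      have "(2::nat) \<le> 2 * 4 ^ w" using one_le_power[of "4::nat" w] by simp
      moreover have "(4::nat) * 4 ^ w \<le> 4 ^ w * 4 ^ w"
        using w power_increasing[of 1 w "4::nat"] by simp
      moreover have "(4::nat) ^ w * 4 ^ w = 16 ^ w" by (simp flip: power_mult_distrib)
      moreover have "n \<le> 2 * 4 ^ w + 2" using n(5) by (simp add: power_mult)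
      ultimately show ?thesis by linarith
    qed
    then have "b * n \<le> m * 16 ^ (w + 1) * 16 ^ w" using A(6) by (intro mult_le_mono)
    also have "\<dots> = m * 16 ^ (2 * w + 1)" by (simp add: power_add mult_2)
    finally have b': "b * n \<le> m * 16 ^ (2 * w + 1)" .
    have "1 / real n + (1 - 1 / real m - real a / real b) =
        1 - 1 / real m - real a' / real (b * n)"
      unfolding x' x_def by simp
    then have "egyptian (insert n A) (1 - 1 / real m - real a' / real (b * n))"
      using egyptian_insert[OF A(8) nA n(2)] by metis
    moreover have "\<forall>k\<in>insert n A. real a' / real (b * n) < 1 / real k"
    proof -
      have "x - 1 / real n < x" using n by simp
      then have "\<forall>k\<in>A. x - 1 / real n < 1 / real k"
        using A(9) unfolding x_def by (meson less_trans)
      then show ?thesis using x' n(6) by auto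
    qed
    moreover have "0 < a'" "0 < b * n" using ba A n by (auto simp: a'_def)
    moreover have "finite (insert n A)" "m \<notin> insert n A" "card (insert n A) \<le> Suc j + 2"
      using A n nA by auto
    ultimately show ?thesis using b' small unfolding w(2) by blast
  qed
qed

section \<open>Short expansions of 1 containing 1/m\<close>

text \<open>Greedy terms, 1/m and the expansion of the remainder are disjoint by size: the greedy
  fractions exceed the remainder a/b and avoid m, while those of \<open>B\<close> are at most a/b <
  1/m. The count is at most (2t + 4) + 1 + 46t \<le> 53t.\<close>

lemma short_expansion:
  assumes m: "7 \<le> m" "m \<le> 2 ^ (t * t)" and t: "1 \<le> t"
  shows "\<exists>A. egyptian A 1 \<and> m \<in> A \<and> card A \<le> 53 * t \<and> (\<exists>n\<in>A. m < n)"
proof -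
  have "1 \<le> 2 * t * t" using t by simp
  then obtain i where i: "2 ^ i \<le> 2 * t * t" "2 * t * t < 2 ^ (i + 1)"
    using ex_power_ivl1[of 2 "2 * t * t"] by auto
  \<comment> \<open>The least j with 2^j > 2t^2: the remainder falls below 2^-(2t^2), while 2^j + 1
    \<le> 5t^2 bounds b by 2^(t^2) * 16^(5t^2) = 2^(21t^2).\<close>
  define j where "j = i + 1"
  have j: "2 * t * t < 2 ^ j" "2 ^ j \<le> 4 * t * t" using i by (auto simp: j_def)
  have "j \<le> 2 * t + 2"
  proof -
    have "t < 2 ^ t" by (rule less_exp)
    then have "t * t < 2 ^ t * 2 ^ t" using t by (intro mult_strict_mono) auto
    then have "(2::nat) ^ j < 2 ^ (2 * t + 2)" using j(2) by (simp add: power_add mult_2)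
    then have "j < 2 * t + 2" by (rule power_less_imp_less_exp[rotated]) simp
    then show ?thesis by simp
  qed
  obtain A a b where A: "finite A" "m \<notin> A" "card A \<le> j + 2" "0 < a" "0 < b"
    "b \<le> m * 16 ^ (2 ^ j + 1)" "real a / real b < 1 / 2 ^ (2 ^ j + 1)"
    "egyptian A (1 - 1 / real m - real a / real b)" "\<forall>n\<in>A. real a / real b < 1 / real n"
    using greedy_remainder[OF m(1), of j] by blast
  have "m * 16 ^ (2 ^ j + 1) \<le> 2 ^ (t * t) * (2 ^ 4) ^ (5 * t * t)"
  proof -
    have "1 \<le> t * t" using t by simp
    then have "(2::nat) ^ j + 1 \<le> 5 * t * t" using j(2) by linarith
    then have "(16::nat) ^ (2 ^ j + 1) \<le> 16 ^ (5 * t * t)" by (intro power_increasing) auto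
    then show ?thesis using m(2) by (simp add: mult_le_mono)
  qed
  also have "\<dots> = 2 ^ (21 * t * t)"
    unfolding power_mult[symmetric] power_add[symmetric] by (simp add: algebra_simps)
  finally have b: "b \<le> 2 ^ (21 * t * t)" using A(6) by linarith
  have pw: "(2::real) ^ (2 * t * t) \<le> 2 ^ (2 ^ j + 1)" using j by (intro power_increasing) auto
  have xs: "real a / real b < 1 / 2 ^ (2 * t * t)"
    using A(7) pw by (smt (verit) divide_left_mono zero_less_power mult_pos_pos)
  then have "real (a * 2 ^ (2 * t * t)) < real b" using A(5) by (simp add: field_simps)
  then have "a * 2 ^ (2 * t * t) < b" by linarith
  then obtain B where B: "egyptian B (real a / real b)" "card B \<le> 46 * t"
    using small_fraction_egyptian[OF t A(5) b] by blast
  have xm: "real a / real b < 1 / real m"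
  proof -
    have "real m \<le> 2 ^ (t * t)" using m(2) by (metis of_nat_le_iff of_nat_numeral of_nat_power)
    also have "\<dots> \<le> 2 ^ (2 * t * t)" by (intro power_increasing) auto
    finally have "1 / 2 ^ (2 * t * t) \<le> 1 / real m" using m(1) by (intro divide_left_mono) auto
    then show ?thesis using xs by linarith
  qed
  have gt: "m < n" if "n \<in> B" for n
  proof -
    have "0 < n" using B that by (auto simp: egyptian_def)
    moreover have "1 / real n < 1 / real m" using egyptian_member_le[OF B(1) that] xm by linarith
    ultimately show ?thesis using m(1) by (simp add: field_simps)
  qed
  have "A \<inter> B = {}" using A(9) egyptian_member_le[OF B(1)] by force
  then have AB: "egyptian (A \<union> B) (1 - 1 / real m)" using egyptian_Un[OF A(8) B(1)] by simp
  have mAB: "m \<notin> A \<union> B" using A(2) gt by auto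
  have "egyptian (insert m (A \<union> B)) 1" using egyptian_insert[OF AB mAB] m(1) by simp
  \<comment> \<open>As a/b > 0, \<open>B\<close> is nonempty; a denominator above m can later be
    split without losing m.\<close>
  moreover have "\<exists>n\<in>B. m < n"
  proof -
    have "B \<noteq> {}" using B(1) A(4,5) by (auto simp: egyptian_def)
    then show ?thesis using gt by blast
  qed
  moreover have "card (insert m (A \<union> B)) \<le> 53 * t"
  proof -
    have "finite (A \<union> B)" using AB by (simp add: egyptian_def)
    then have "card (insert m (A \<union> B)) \<le> Suc (card (A \<union> B))" by (simp add: card_insert_if)
    also have "\<dots> \<le> Suc (card A + card B)" using card_Un_le by simp
    finally show ?thesis using A(3) B(2) \<open>j \<le> 2 * t + 2\<close> t by linarith
  qed
  ultimately show ?thesis by (intro exI[of _ "insert m (A \<union> B)"]) auto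
qed

section \<open>Reaching every larger length\<close>

text \<open>Splitting the largest denominator M produces M + 1 and M(M + 1), which are distinct and
  exceed all others. Since m < M, m survives and still lies below another denominator, so the step
  can be repeated.\<close>

lemma egyptian_split_Max:
  assumes A: "egyptian A 1" and m: "m \<in> A" and n: "n \<in> A" "m < n"
  shows "\<exists>A'. egyptian A' 1 \<and> m \<in> A' \<and> card A' = Suc (card A) \<and> (\<exists>n\<in>A'. m < n)"
proof -
  have fin: "finite A" using A by (simp add: egyptian_def)
  define M where "M = Max A"
  have M: "M \<in> A" "m < M" "\<And>x. x \<in> A \<Longrightarrow> x \<le> M"
    using Max_in[OF fin] Max_ge[OF fin] n unfolding M_def by (blast, meson less_le_trans, blast)
  have A0: "egyptian (A - {M}) (1 - 1 / real M)"
    using A M(1) fin by (auto simp: egyptian_def sum_diff1)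
  have A1: "egyptian (insert (M + 1) (A - {M})) (1 / real (M + 1) + (1 - 1 / real M))"
    using A0 M(3)[of "M + 1"] by (intro egyptian_insert) auto
  have "M + 1 < M * (M + 1)"
  proof -
    have "0 < m" using A m by (auto simp: egyptian_def)
    then have "2 \<le> M" using M(2) by linarith
    then have "1 * (M + 1) < M * (M + 1)" by (intro mult_strict_right_mono) auto
    then show ?thesis by simp
  qed
  then have new: "M * (M + 1) \<notin> insert (M + 1) (A - {M})" "M + 1 \<notin> A - {M}"
    using M(3)[of "M * (M + 1)"] M(3)[of "M + 1"] by auto
  let ?A = "insert (M * (M + 1)) (insert (M + 1) (A - {M}))"
  have "egyptian ?A (1 / real (M * (M + 1)) + (1 / real (M + 1) + (1 - 1 / real M)))"
    using M(2) by (intro egyptian_insert[OF A1 new(1)]) auto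
  also have "1 / real (M * (M + 1)) + (1 / real (M + 1) + (1 - 1 / real M)) = 1"
  proof -
    have "1 / (x * (x + 1)) + (1 / (x + 1) + (1 - 1 / x)) = 1" if "0 < x" for x :: real
    proof -
      have "x \<noteq> 0" "x + 1 \<noteq> 0" using that by auto
      then show ?thesis by (simp add: divide_simps) (simp add: algebra_simps)
    qed
    from this[of "real M"] show ?thesis
      using M(2) by (simp only: of_nat_mult of_nat_add of_nat_1 of_nat_0_less_iff)
  qed
  finally have "egyptian ?A 1" .
  moreover have "card ?A = Suc (card A)"
  proof -
    have "card ?A = Suc (Suc (card (A - {M})))"
      using fin by (simp only: card_insert_disjoint[OF _ new(1)] card_insert_disjoint[OF _ new(2)]
        finite_insert finite_Diff)
    then show ?thesis using card_Suc_Diff1[OF fin M(1)] by simp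
  qed
  moreover have "m \<in> ?A" "\<exists>n\<in>?A. m < n" using m M(2) by auto
  ultimately show ?thesis by blast
qed

lemma egyptian_imp_mem_D:
  assumes "egyptian A 1" "m \<in> A"
  shows "m \<in> D (card A)"
proof -
  let ?ns = "sorted_list_of_set A"
  have fin: "finite A" using assms by (simp add: egyptian_def)
  have "(\<Sum>n\<leftarrow>?ns. 1 / real n) = (\<Sum>n\<in>A. 1 / real n)"
    using fin by (simp add: sum_list_distinct_conv_sum_set)
  then have "?ns \<in> S (card A)"
    using assms fin by (auto simp: S_def egyptian_def Suc_le_eq)
  then show ?thesis using assms fin by (auto simp: D_def intro!: bexI[of _ ?ns])
qed

lemma mem_D_of_egyptian:
  assumes "card A \<le> k" "egyptian A 1" "m \<in> A" "\<exists>n\<in>A. m < n"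
  shows "m \<in> D k"
proof -
  have "\<exists>A. egyptian A 1 \<and> m \<in> A \<and> card A = k \<and> (\<exists>n\<in>A. m < n)"
    using assms(1)
  proof (induction k rule: dec_induct)
    case base
    then show ?case using assms by blast
  next
    case (step k)
    then show ?case using egyptian_split_Max by metis
  qed
  then show ?thesis using egyptian_imp_mem_D by blast
qed

lemma mem_D:
  assumes "1 < m" "m \<le> 2 ^ (t * t)" "1 \<le> t" "53 * t \<le> k"
  shows "m \<in> D k"
proof (cases "7 \<le> m")
  case True
  then show ?thesis using short_expansion[of m t] assms mem_D_of_egyptian by (meson order_trans)
next
  case False
  \<comment> \<open>The values 2 to 6, out of reach of the greedy start, occur in these, each below
    the last denominator.\<close>
  have e: "egyptian {2, 3, 7, 42} 1" "egyptian {2, 4, 6, 12} 1" "egyptian {2, 4, 5, 20} 1"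
    by (simp_all add: egyptian_def)
  have "m \<in> {2, 3, 7} \<or> m \<in> {4, 6} \<or> m = 5" using False assms(1) by auto
  then show ?thesis
    using mem_D_of_egyptian[OF _ e(1), of k m] mem_D_of_egyptian[OF _ e(2), of k m]
      mem_D_of_egyptian[OF _ e(3), of k m] assms(3,4) by auto
qed

section \<open>The lower bound for v(k)\<close>

theorem theorem1:
  "\<exists>c::real. c > 0 \<and> (\<forall>k::nat. k \<ge> 1 \<longrightarrow> real (v k) \<ge> exp (c * (real k)^2))"
proof (intro exI[of _ "1 / 30000"] conjI allI impI)
  fix k :: nat assume "1 \<le> k"
  have half: "1 / 2 \<le> ln (2::real)" using ln_le_minus_one[of "1 / 2 :: real"] by (simp add: ln_div)
  have v: "1 < v k" "v k \<notin> D k" using v_attained by auto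
  show "exp (1 / 30000 * (real k)\<^sup>2) \<le> real (v k)"
  \<comment> \<open>For k < 53 no t \<ge> 1 is available, but v(k) \<ge> 2 suffices since 53^2 /
    30000 < 1/2 \<le> ln 2.\<close>
  proof (cases "k < 53")
    case True
    then have "(real k)\<^sup>2 \<le> 53\<^sup>2" by (intro power_mono) auto
    then have "1 / 30000 * (real k)\<^sup>2 \<le> ln 2" using half by simp
    then have "exp (1 / 30000 * (real k)\<^sup>2) \<le> exp (ln 2)" by (simp only: exp_le_cancel_iff)
    then have "exp (1 / 30000 * (real k)\<^sup>2) \<le> 2" by simp
    then show ?thesis using v by linarith
  next
    case False
    define t where "t = k div 53"
    have "k < 53 * t + 53" and t: "53 * t \<le> k" "1 \<le> t"
      using False div_mult_mod_eq[of k 53] mod_less_divisor[of 53 k] by (auto simp: t_def)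
    then have k: "k \<le> 106 * t" by linarith
    have "2 ^ (t * t) < v k" using mem_D[of "v k" t k] v t by force
    then have vk: "(2::real) ^ (t * t) \<le> real (v k)"
      by (metis less_imp_le of_nat_le_iff of_nat_numeral of_nat_power)
    \<comment> \<open>The constant works because 106^2 / 30000 = 11236 / 30000 < 1/2 \<le> ln
      2.\<close>
    have "(real k)\<^sup>2 \<le> (106 * real t)\<^sup>2" using k by (intro power_mono) auto
    then have "(real k)\<^sup>2 \<le> 11236 * (real t)\<^sup>2" by (simp add: power_mult_distrib)
    then have "1 / 30000 * (real k)\<^sup>2 \<le> (real t)\<^sup>2 * (1 / 2)"
      using zero_le_power2[of "real t"] by linarith
    also have "\<dots> \<le> (real t)\<^sup>2 * ln 2" using half by (intro mult_left_mono) auto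
    also have "\<dots> = ln (2 ^ (t * t))" by (simp add: ln_realpow power2_eq_square)
    finally have "exp (1 / 30000 * (real k)\<^sup>2) \<le> exp (ln (2 ^ (t * t)))"
      by (simp only: exp_le_cancel_iff)
    then have "exp (1 / 30000 * (real k)\<^sup>2) \<le> 2 ^ (t * t)" by simp
    then show ?thesis using vk by linarith
  qed
qed simp

end
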